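(* Let $\mathcal{H}$ be a real Hilbert space and let $f:\mathcal{H}\to\mathbb{R}\cup\{+\infty\}$ be a convex, lower semicontinuous and proper function such that $S=\operatorname{argmin} f\neq\emptyset$. Let $x^*$ be the element of minimum norm of $S$. Let $\alpha>3$, $\delta>1$ (so that $\alpha+2\delta>5$), and $t_0>0$. Let $x:[t_0,+\infty[\to\mathcal{H}$ be a solution trajectory, in the generalized sense given in the context, of $$\ddot x(t)+\frac{\alpha+2\delta}{t}\,\dot x(t)+\partial f\left(x(t)+\frac{t}{\alpha-1}\dot x(t)\right)+\frac{2\delta(\alpha-1)}{t^2}\,x(t)\ni 0,$$ which satisfies the initial conditions $x(t_0)\in\operatorname{dom} f$ and $\dot x(t_0)=0$. Then the following properties are satisfied: (i) $f(x(t))-\min_{\mathcal{H}} f=\mathcal{O}\left(\frac{1}{t^2}\right)$ as $t\to+\infty$; (ii) $x(t)$ converges strongly (in norm) to the minimum norm solution $x^*$ as $t\to+\infty$.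
   Context: $\partial f$ is the convex subdifferential and $\operatorname{dom} f=\{f<+\infty\}$. The second-order inclusion is understood in the following generalized sense: there is a function $v:[t_0,+\infty[\to\mathcal{H}$ such that $(v,x)$ is a strong solution of the first-order system $$\dot v(t)+\frac{t}{\alpha-1}\partial f(v(t))+\frac{2\delta}{t}v(t)\ni 0,\qquad \dot x(t)+\frac{\alpha-1}{t}\,(x(t)-v(t))=0,$$ which is the system $\dot v(t)+\frac{t}{\alpha-1}\partial f(v(t))+\frac{t}{\alpha-1}\varepsilon\left(\frac{t^2}{2(\alpha-1)}\right)v(t)\ni0$, $\dot x(t)+\frac{\alpha-1}{t}(x(t)-v(t))=0$ with $\varepsilon(t)=\delta/t$. The initial conditions $x(t_0)=x_0\in\operatorname{dom} f$, $\dot x(t_0)=0$ mean $v(t_0)=x(t_0)=x_0\in\operatorname{dom} f$. Strong solution (in the sense of Brezis): $(v,x)$ is continuous on $[t_0,+\infty[$, absolutely continuous on compact intervals, and satisfies the system for almost every $t\geq t_0$. $\mathcal{O}(g(t))$ means bounded by a constant times $g(t)$ for $t$ large. *)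

theory Defs
  imports "HOL-Analysis.Analysis" "HOL-Library.Landau_Symbols"
begin

definition proper :: "('a \<Rightarrow> ereal) \<Rightarrow> bool" where
  "proper f \<longleftrightarrow> (\<forall>x. f x \<noteq> -\<infinity>) \<and> (\<exists>x. f x < \<infinity>)"

(* The library's convex_on only covers real-valued functions. The endpoints s = 0, 1 are harmless,
   since 0 * \<infinity> = 0 in ereal. *)
definition ereal_convex :: "('a::real_vector \<Rightarrow> ereal) \<Rightarrow> bool" where
  "ereal_convex f \<longleftrightarrow>
     (\<forall>x y. \<forall>s\<in>{0..1}. f ((1 - s) *\<^sub>R x + s *\<^sub>R y) \<le> ereal (1 - s) * f x + ereal s * f y)"

definition lower_semicontinuous :: "('a::topological_space \<Rightarrow> ereal) \<Rightarrow> bool" where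
  "lower_semicontinuous f \<longleftrightarrow> (\<forall>x. f x \<le> Liminf (nhds x) f)"

definition effective_domain :: "('a \<Rightarrow> ereal) \<Rightarrow> 'a set" where
  "effective_domain f = {x. f x < \<infinity>}"

definition argmin_set :: "('a \<Rightarrow> ereal) \<Rightarrow> 'a set" where
  "argmin_set f = {x. is_arg_min f (\<lambda>_. True) x}"

(* For proper f this set is empty at points outside the effective domain. *)
definition subdifferential :: "('a::real_inner \<Rightarrow> ereal) \<Rightarrow> 'a \<Rightarrow> 'a set" where
  "subdifferential f x = {g. \<forall>y. f x + ereal (g \<bullet> (y - x)) \<le> f y}"

definition abs_continuous_on_interval :: "(real \<Rightarrow> 'a::real_normed_vector) \<Rightarrow> real \<Rightarrow> real \<Rightarrow> bool" where
  "abs_continuous_on_interval u c d \<longleftrightarrow>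
     (\<forall>e>0. \<exists>\<eta>>0. \<forall>(n::nat) a b.
        (\<forall>i<n. c \<le> a i \<and> a i \<le> b i \<and> b i \<le> d) \<and>
        disjoint_family_on (\<lambda>i. {a i<..<b i}) {..<n} \<and>
        (\<Sum>i<n. b i - a i) < \<eta>
        \<longrightarrow> (\<Sum>i<n. norm (u (b i) - u (a i))) < e)"

(* Trajectories are total functions on real; only their values on [t0, \<infinity>) matter (the two-sided
   derivative at t0 itself is irrelevant, {t0} being a null set). *)
definition strong_solution ::
  "('a::real_inner \<Rightarrow> ereal) \<Rightarrow> real \<Rightarrow> real \<Rightarrow> real \<Rightarrow> (real \<Rightarrow> 'a) \<Rightarrow> (real \<Rightarrow> 'a) \<Rightarrow> bool" where
  "strong_solution f \<alpha> \<delta> t0 v x \<longleftrightarrow>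
     continuous_on {t0..} v \<and> continuous_on {t0..} x \<and>
     (\<forall>c d. t0 \<le> c \<and> c \<le> d \<longrightarrow>
        abs_continuous_on_interval v c d \<and> abs_continuous_on_interval x c d) \<and>
     (AE t in lborel. t0 \<le> t \<longrightarrow>
        (\<exists>v' x'. (v has_vector_derivative v') (at t) \<and> (x has_vector_derivative x') (at t) \<and>
           0 \<in> (\<lambda>g. v' + (t / (\<alpha> - 1)) *\<^sub>R g + (2 * \<delta> / t) *\<^sub>R v t) ` subdifferential f (v t) \<and>
           x' + ((\<alpha> - 1) / t) *\<^sub>R (x t - v t) = 0))"

(* Generalized solutions of
     x'' + ((\<alpha> + 2 \<delta>) / t) x' + \<partial>f (x + (t / (\<alpha> - 1)) x') + (2 \<delta> (\<alpha> - 1) / t^2) x \<ni> 0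
   with x t0 in dom f and x' t0 = 0. Here v stands for x + (t / (\<alpha> - 1)) x', so the condition
   x' t0 = 0 becomes v t0 = x t0. *)
definition generalized_solution ::
  "('a::real_inner \<Rightarrow> ereal) \<Rightarrow> real \<Rightarrow> real \<Rightarrow> real \<Rightarrow> (real \<Rightarrow> 'a) \<Rightarrow> bool" where
  "generalized_solution f \<alpha> \<delta> t0 x \<longleftrightarrow>
     (\<exists>v. strong_solution f \<alpha> \<delta> t0 v x \<and> v t0 = x t0 \<and> x t0 \<in> effective_domain f)"

end

theory Submission
  imports Defs
begin

text \<open>
  Write \<open>z\<close> for the minimizer of least norm, \<open>m\<close> for the minimum and \<open>\<theta> = |v - z|\<^sup>2 / 2\<close>. Everything
  is drawn from one estimate: testing the subgradient inequality at \<open>v\<close> against \<open>z\<close> gives, for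
  almost every \<open>t\<close>,

  \<open>t / (\<alpha> - 1) * (f v - m) \<le> - \<theta>' - \<delta> / t * (|v|\<^sup>2 + 2 * \<theta> - |z|\<^sup>2)\<close>.

  Strong convergence. Points where \<open>f\<close> is close to \<open>m\<close> have almost at least the norm of \<open>z\<close>: the
  sublevel sets of \<open>f\<close> are nested closed convex sets, and by the parallelogram law almost shortest
  elements of such sets form a Cauchy sequence (\<open>min_norm_of_near_minimizers\<close>). Where \<open>f v\<close> is not
  close to \<open>m\<close>, the left side of the estimate, whose coefficient grows with \<open>t\<close>, outweighs the
  remaining terms, which are \<open>O(1 / t)\<close>. In both cases \<open>\<theta>' \<le> 2 * \<delta> / t * (\<eta> - \<theta>)\<close> for large \<open>t\<close>,
  whatever \<open>\<eta> > 0\<close>, so \<open>t powr (2 * \<delta>) * (\<theta> - \<eta>)\<close> decreases and \<open>\<theta>\<close> tends to \<open>0\<close>. The equation for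
  \<open>x\<close> yields the same kind of inequality for \<open>|x - z|\<^sup>2 / 2\<close>, with exponent \<open>\<alpha> - 1\<close>.

  Rate. With \<open>p = \<alpha> - 1\<close> the equation for \<open>x\<close> says that \<open>t powr p * x t\<close> has the derivative
  \<open>p * t powr (p - 1) * v t\<close>, so \<open>x\<close> is a weighted average of past values of \<open>v\<close>. The estimate above
  bounds \<open>p * t powr (p - 1) * (f v - m)\<close> by the derivative of \<open>p\<^sup>2 * t powr (p - 2) * (E - \<theta> t)\<close> for a
  suitable constant \<open>E\<close>; this is where \<open>p > 2\<close>, that is \<open>\<alpha> > 3\<close>, enters. Jensen's inequality then
  gives \<open>t powr p * (f (x t) - m) \<le> p\<^sup>2 * E * t powr (p - 2)\<close>.

  Both halves rest on one mean value theorem, \<open>increment_in_closed_convex_cone\<close>: an absolutely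
  continuous curve whose derivative lies almost everywhere in a closed convex cone has its increment
  in that cone. The negative half line gives monotonicity from the sign of the derivative; the
  closed cone over the epigraph of \<open>f\<close> gives Jensen's inequality.
\<close>

section \<open>Increments of absolutely continuous curves\<close>

text \<open>
  Absolute continuity in the form needed for gauge arguments: finite families of intervals become
  tagged partial divisions.
\<close>

lemma abs_continuous_tagged:
  assumes ac: "abs_continuous_on_interval u a b" and "0 < e"
  obtains \<eta> where "0 < \<eta>"
    "\<And>q. q tagged_partial_division_of {a..b} \<Longrightarrow> (\<Sum>(x,K)\<in>q. Sup K - Inf K) < \<eta> \<Longrightarrow>
       (\<Sum>(x,K)\<in>q. norm (u (Sup K) - u (Inf K))) < e"
proof -
  obtain \<eta> where \<eta>: "0 < \<eta>"
    and ac': "\<And>(n::nat) c d. (\<forall>i<n. a \<le> c i \<and> c i \<le> d i \<and> d i \<le> b) \<Longrightarrow>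
        disjoint_family_on (\<lambda>i. {c i<..<d i}) {..<n} \<Longrightarrow> (\<Sum>i<n. d i - c i) < \<eta> \<Longrightarrow>
        (\<Sum>i<n. norm (u (d i) - u (c i))) < e"
    using ac \<open>0 < e\<close> unfolding abs_continuous_on_interval_def by meson
  have "(\<Sum>(x,K)\<in>q. norm (u (Sup K) - u (Inf K))) < e"
    if q: "q tagged_partial_division_of {a..b}" and len: "(\<Sum>(x,K)\<in>q. Sup K - Inf K) < \<eta>" for q
  proof -
    have "finite q"
      using q by (rule tagged_partial_division_ofD)
    then obtain h where h: "bij_betw h {..<card q} q"
      using ex_bij_betw_nat_finite atLeast0LessThan by metis
    define c where "c i = Inf (snd (h i))" for i
    define d where "d i = Sup (snd (h i))" for i
    have mem: "h i \<in> q" if "i < card q" for i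
      using h that by (auto simp: bij_betw_def)
    have K: "snd (h i) = {c i..d i} \<and> a \<le> c i \<and> c i \<le> d i \<and> d i \<le> b" if i: "i < card q" for i
    proof -
      have 1: "(fst (h i), snd (h i)) \<in> q"
        using mem[OF i] by simp
      obtain l r where lr: "snd (h i) = {l..r}"
        using tagged_partial_division_ofD(4)[OF q 1] by (auto simp: cbox_interval)
      have "l \<le> r" "{l..r} \<subseteq> {a..b}"
        using tagged_partial_division_ofD(2,3)[OF q 1] lr by auto
      then show ?thesis
        using lr by (auto simp: c_def d_def)
    qed
    have "disjoint_family_on (\<lambda>i. {c i<..<d i}) {..<card q}"
      unfolding disjoint_family_on_def
    proof (intro ballI impI)
      fix i j assume ij: "i \<in> {..<card q}" "j \<in> {..<card q}" "i \<noteq> j"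
      then have "h i \<noteq> h j"
        using h by (auto simp: bij_betw_def inj_on_def)
      then have "interior (snd (h i)) \<inter> interior (snd (h j)) = {}"
        using tagged_partial_division_ofD(5)[OF q, of "fst (h i)" "snd (h i)" "fst (h j)" "snd (h j)"]
          mem ij by (simp add: prod_eq_iff)
      then show "{c i<..<d i} \<inter> {c j<..<d j} = {}"
        using K ij by simp
    qed
    moreover have "(\<Sum>i<card q. d i - c i) < \<eta>"
      using len sum.reindex_bij_betw[OF h, of "\<lambda>y. Sup (snd y) - Inf (snd y)"]
      by (simp add: c_def d_def case_prod_beta)
    ultimately have "(\<Sum>i<card q. norm (u (d i) - u (c i))) < e"
      using K by (intro ac') auto
    then show ?thesis
      using sum.reindex_bij_betw[OF h, of "\<lambda>y. norm (u (Sup (snd y)) - u (Inf (snd y)))"]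
      by (simp add: c_def d_def case_prod_beta)
  qed
  with \<eta> that show ?thesis by blast
qed

lemma tagged_partial_division_length_le:
  fixes q :: "(real \<times> real set) set"
  assumes q: "q tagged_partial_division_of {a..b}" and U: "U \<in> lmeasurable"
    and sub: "\<And>x K. (x,K) \<in> q \<Longrightarrow> K \<subseteq> U"
  shows "(\<Sum>(x,K)\<in>q. Sup K - Inf K) \<le> measure lebesgue U"
proof -
  have div: "snd ` q division_of \<Union>(snd ` q)"
    by (rule partial_division_of_tagged_division[OF q])
  have "(\<Sum>(x,K)\<in>q. Sup K - Inf K) = (\<Sum>(x,K)\<in>q. measure lborel K)"
  proof (rule sum.cong, simp, safe)
    fix x K assume 1: "(x,K) \<in> q"
    obtain l r where lr: "K = {l..r}"
      using tagged_partial_division_ofD(4)[OF q 1] by (auto simp: cbox_interval)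
    moreover have "l \<le> r"
      using tagged_partial_division_ofD(2)[OF q 1] lr by auto
    ultimately show "Sup K - Inf K = measure lborel K"
      by simp
  qed
  also have "\<dots> = (\<Sum>K\<in>snd ` q. measure lborel K)"
    by (rule sum.over_tagged_division_lemma[OF tagged_partial_division_of_Union_self[OF q]])
       (simp add: content_eq_0_interior)
  also have "\<dots> = (\<Sum>K\<in>snd ` q. measure lebesgue K)"
    using division_ofD(4)[OF div] by (intro sum.cong refl) (metis lmeasurable_cbox measure_completion fmeasurableD sets_lborel borel_closed closed_cbox)
  also have "\<dots> = measure lebesgue (\<Union>(snd ` q))"
    by (rule content_division[OF div])
  also have "\<dots> \<le> measure lebesgue U"
    using sub by (intro measure_mono_fmeasurable U fmeasurableD lmeasurable_division[OF div]) fastforce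
  finally show ?thesis .
qed

text \<open>
  The straddle lemma: intervals around the tag are compared with the derivative at the tag.
\<close>

lemma increment_near_derivative:
  fixes u :: "real \<Rightarrow> 'b::real_normed_vector"
  assumes "l \<le> t" "t \<le> r"
    and "norm (u l - u t - (l - t) *\<^sub>R d) \<le> e * \<bar>l - t\<bar>"
    and "norm (u r - u t - (r - t) *\<^sub>R d) \<le> e * \<bar>r - t\<bar>"
  shows "norm (u r - u l - (r - l) *\<^sub>R d) \<le> e * (r - l)"
proof -
  have "u r - u l - (r - l) *\<^sub>R d = (u r - u t - (r - t) *\<^sub>R d) - (u l - u t - (l - t) *\<^sub>R d)"
    by (simp add: algebra_simps)
  also have "norm \<dots> \<le> e * \<bar>r - t\<bar> + e * \<bar>l - t\<bar>"
    using assms(3,4) by (meson add_mono norm_triangle_ineq4 order_trans)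
  also have "\<dots> = e * (r - l)"
    using assms(1,2) by (simp add: algebra_simps)
  finally show ?thesis .
qed

lemma convex_cone_sum:
  assumes "convex_cone C" and "\<And>i. i \<in> I \<Longrightarrow> g i \<in> C"
  shows "sum g I \<in> C"
  using assms(2)
  by (induction I rule: infinite_finite_induct)
     (auto simp: convex_cone_contains_0[OF assms(1)] intro: convex_cone_add[OF assms(1)])

text \<open>
  Choose a gauge that makes the curve almost linear near each point of differentiability and that
  keeps the intervals tagged in the exceptional null set inside an open set of small measure. Along a
  fine tagged division, the first kind of interval contributes almost a nonnegative combination of
  derivatives, which lies in the cone; by absolute continuity the second kind contributes
  almost nothing. Closedness of the cone finishes the proof.
\<close>

lemma increment_in_closed_convex_cone:
  fixes u :: "real \<Rightarrow> 'b::real_normed_vector"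
  assumes ab: "a \<le> b" and ac: "abs_continuous_on_interval u a b"
    and C: "convex_cone C" "closed C"
    and deriv: "AE t in lborel. a \<le> t \<and> t \<le> b \<longrightarrow> (\<exists>d\<in>C. (u has_vector_derivative d) (at t))"
  shows "u b - u a \<in> C"
proof -
  have "\<exists>y\<in>C. dist y (u b - u a) < \<epsilon>" if "0 < \<epsilon>" for \<epsilon>
  proof -
    define e where "e = \<epsilon> / (2 * (b - a + 1))"
    have e: "0 < e" "e * (b - a) \<le> \<epsilon> / 2"
      using ab \<open>0 < \<epsilon>\<close> by (auto simp: e_def field_simps)
    obtain \<eta> where \<eta>: "0 < \<eta>"
      "\<And>q. q tagged_partial_division_of {a..b} \<Longrightarrow> (\<Sum>(x,K)\<in>q. Sup K - Inf K) < \<eta> \<Longrightarrow>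
         (\<Sum>(x,K)\<in>q. norm (u (Sup K) - u (Inf K))) < \<epsilon> / 2"
      using abs_continuous_tagged[OF ac, of "\<epsilon> / 2"] \<open>0 < \<epsilon>\<close> by auto
    obtain N where N: "N \<in> null_sets lborel"
      and sub: "{t \<in> space lborel. \<not> (a \<le> t \<and> t \<le> b \<longrightarrow> (\<exists>d\<in>C. (u has_vector_derivative d) (at t)))} \<subseteq> N"
      using deriv unfolding eventually_ae_filter by blast
    have "\<exists>d. t \<notin> N \<longrightarrow> a \<le> t \<longrightarrow> t \<le> b \<longrightarrow> d \<in> C \<and> (u has_vector_derivative d) (at t)" for t
      using sub by auto
    then obtain d where d: "\<And>t. t \<notin> N \<Longrightarrow> a \<le> t \<Longrightarrow> t \<le> b \<Longrightarrow> d t \<in> C"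
      "\<And>t. t \<notin> N \<Longrightarrow> a \<le> t \<Longrightarrow> t \<le> b \<Longrightarrow> (u has_vector_derivative d t) (at t)"
      by metis
    have N': "N \<in> null_sets lebesgue"
      using N by (rule null_sets_completionI)
    obtain U where U: "open U" "N \<subseteq> U" "U - N \<in> lmeasurable" "emeasure lebesgue (U - N) < ennreal \<eta>"
      using sets_lebesgue_outer_open[of N \<eta>] N' \<eta>(1) by blast
    have emU: "emeasure lebesgue U = emeasure lebesgue (U - N)"
      using N' U(1) by (subst emeasure_Diff_null_set) auto
    have Um: "U \<in> lmeasurable"
      using U(1,3) emU by (auto simp: fmeasurable_def)
    have "measure lebesgue U < \<eta>"
      using U(4) emU Um by (metis emeasure_eq_measure2 ennreal_less_iff measure_nonneg)
    have "\<exists>r>0. (t \<in> N \<longrightarrow> ball t r \<subseteq> U) \<and> (t \<notin> N \<longrightarrow> a \<le> t \<longrightarrow> t \<le> b \<longrightarrow>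
        (\<forall>y. \<bar>y - t\<bar> < r \<longrightarrow> norm (u y - u t - (y - t) *\<^sub>R d t) \<le> e * \<bar>y - t\<bar>))" for t
    proof (cases "t \<in> N")
      case True
      then show ?thesis
        using U(1,2) by (meson openE subsetD)
    next
      case False
      show ?thesis
      proof (cases "a \<le> t \<and> t \<le> b")
        case True
        then have "(u has_derivative (\<lambda>h. h *\<^sub>R d t)) (at t)"
          using d(2) False by (simp add: has_vector_derivative_def)
        then show ?thesis
          using e(1) False by (auto simp: has_derivative_at_alt)
      qed (use False in \<open>auto intro: exI[of _ 1]\<close>)
    qed
    then obtain \<rho> where \<rho>: "\<And>t. 0 < \<rho> t" "\<And>t. t \<in> N \<Longrightarrow> ball t (\<rho> t) \<subseteq> U"
      "\<And>t y. t \<notin> N \<Longrightarrow> a \<le> t \<Longrightarrow> t \<le> b \<Longrightarrow> \<bar>y - t\<bar> < \<rho> t \<Longrightarrow>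
         norm (u y - u t - (y - t) *\<^sub>R d t) \<le> e * \<bar>y - t\<bar>"
      by metis
    have "gauge (\<lambda>t. ball t (\<rho> t))"
      using \<rho>(1) gauge_ball_dependent by blast
    then obtain p where p: "p tagged_division_of {a..b}" and fine: "(\<lambda>t. ball t (\<rho> t)) fine p"
      using fine_division_exists_real by blast
    \<comment> \<open>The intervals tagged in the exceptional set.\<close>
    define q where "q = {y \<in> p. fst y \<in> N}"
    define y where "y = (\<Sum>(t,K)\<in>p - q. (Sup K - Inf K) *\<^sub>R d t)"
    have "finite p"
      using p by blast
    have shape: "\<exists>l r. K = {l..r} \<and> l \<le> t \<and> t \<le> r \<and> a \<le> l \<and> r \<le> b" if tK: "(t,K) \<in> p" for t K
    proof -
      obtain l r where lr: "K = {l..r}"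
        using tagged_division_ofD(4)[OF p tK] by (auto simp: cbox_interval)
      then show ?thesis
        using tagged_division_ofD(2,3)[OF p tK] by auto
    qed
    have good: "d t \<in> C \<and> 0 \<le> Sup K - Inf K \<and>
        norm (u (Sup K) - u (Inf K) - (Sup K - Inf K) *\<^sub>R d t) \<le> e * (Sup K - Inf K)"
      if tK: "(t,K) \<in> p - q" for t K
    proof -
      obtain l r where lr: "K = {l..r}" "l \<le> t" "t \<le> r" "a \<le> l" "r \<le> b"
        using shape tK by blast
      have "t \<notin> N"
        using tK by (auto simp: q_def)
      have "K \<subseteq> ball t (\<rho> t)"
        using fine tK by (auto simp: fine_def)
      moreover have "l \<in> K" "r \<in> K"
        using lr by auto
      ultimately have "\<bar>l - t\<bar> < \<rho> t" "\<bar>r - t\<bar> < \<rho> t"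
        unfolding subset_iff mem_ball dist_real_def by (metis abs_minus_commute)+
      then have "norm (u r - u l - (r - l) *\<^sub>R d t) \<le> e * (r - l)"
        using lr \<rho>(3)[of t l] \<rho>(3)[of t r] \<open>t \<notin> N\<close> by (intro increment_near_derivative) auto
      then show ?thesis
        using lr d(1) \<open>t \<notin> N\<close> by auto
    qed
    have "y \<in> C"
      unfolding y_def using \<open>finite p\<close> good C(1)
      by (intro convex_cone_sum) (auto intro: convex_cone_scaleR)
    moreover have "dist y (u b - u a) < \<epsilon>"
    proof -
      let ?\<Delta> = "\<lambda>K. u (Sup K) - u (Inf K)"
      have "u b - u a = (\<Sum>(t,K)\<in>p. ?\<Delta> K)"
        using additive_tagged_division_1[OF ab p, of u] by simp
      also have "\<dots> = (\<Sum>(t,K)\<in>p - q. ?\<Delta> K) + (\<Sum>(t,K)\<in>q. ?\<Delta> K)"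
        using \<open>finite p\<close> by (intro sum.subset_diff) (auto simp: q_def)
      finally have split: "u b - u a - y =
          (\<Sum>(t,K)\<in>p - q. ?\<Delta> K - (Sup K - Inf K) *\<^sub>R d t) + (\<Sum>(t,K)\<in>q. ?\<Delta> K)"
        by (simp add: y_def case_prod_beta sum_subtractf)
      have "norm (\<Sum>(t,K)\<in>p - q. ?\<Delta> K - (Sup K - Inf K) *\<^sub>R d t) \<le> (\<Sum>(t,K)\<in>p - q. e * (Sup K - Inf K))"
        using good by (intro sum_norm_le) auto
      also have "\<dots> \<le> (\<Sum>(t,K)\<in>p. e * (Sup K - Inf K))"
      proof (rule sum_mono2)
        fix z assume "z \<in> p - (p - q)"
        then show "0 \<le> (case z of (t,K) \<Rightarrow> e * (Sup K - Inf K))"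
          using shape[of "fst z" "snd z"] e(1) by (cases z) auto
      qed (use \<open>finite p\<close> in auto)
      also have "\<dots> = e * (b - a)"
        using additive_tagged_division_1[OF ab p, of "\<lambda>x. x"]
        by (simp add: case_prod_beta flip: sum_distrib_left)
      finally have 1: "norm (\<Sum>(t,K)\<in>p - q. ?\<Delta> K - (Sup K - Inf K) *\<^sub>R d t) \<le> \<epsilon> / 2"
        using e(2) by linarith
      have q: "q tagged_partial_division_of {a..b}"
        using p by (rule_tac tagged_partial_division_subset) (auto simp: q_def tagged_division_of_def)
      have "K \<subseteq> U" if "(t,K) \<in> q" for t K
        using that fine \<rho>(2)[of t] unfolding q_def fine_def by fastforce
      then have "(\<Sum>(t,K)\<in>q. Sup K - Inf K) < \<eta>"
        using tagged_partial_division_length_le[OF q Um] \<open>measure lebesgue U < \<eta>\<close> by force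
      then have "(\<Sum>(t,K)\<in>q. norm (?\<Delta> K)) < \<epsilon> / 2"
        by (rule \<eta>(2)[OF q])
      then have 2: "norm (\<Sum>(t,K)\<in>q. ?\<Delta> K) < \<epsilon> / 2"
        using norm_sum[of "\<lambda>(t,K). ?\<Delta> K" q] by (simp add: case_prod_beta)
      have "norm (u b - u a - y) < \<epsilon>"
        unfolding split using 1 2 by (intro le_less_trans[OF norm_triangle_ineq]) linarith
      then show ?thesis
        by (simp add: dist_norm norm_minus_commute)
    qed
    ultimately show ?thesis by blast
  qed
  then show ?thesis
    using C(2) closed_approachable by blast
qed

section \<open>Calculus of absolutely continuous functions\<close>

text \<open>
  All closure properties below are instances of this domination principle.
\<close>

lemma abs_continuous_dominated:
  assumes G: "abs_continuous_on_interval G a b" and H: "abs_continuous_on_interval H a b"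
    and dom: "\<And>s t. a \<le> s \<Longrightarrow> s \<le> t \<Longrightarrow> t \<le> b \<Longrightarrow>
      norm (F t - F s) \<le> M * (norm (G t - G s) + norm (H t - H s))"
  shows "abs_continuous_on_interval F a b"
  unfolding abs_continuous_on_interval_def
proof (intro allI impI)
  fix e :: real assume "0 < e"
  define L where "L = \<bar>M\<bar> + 1"
  have "0 < L" "M \<le> L"
    by (auto simp: L_def)
  define e' where "e' = e / (2 * L)"
  have "0 < e'"
    using \<open>0 < e\<close> \<open>0 < L\<close> by (simp add: e'_def)
  define small where "small u \<eta> \<longleftrightarrow> (\<forall>(n::nat) c d. (\<forall>i<n. a \<le> c i \<and> c i \<le> d i \<and> d i \<le> b) \<and>
        disjoint_family_on (\<lambda>i. {c i<..<d i}) {..<n} \<and> (\<Sum>i<n. d i - c i) < \<eta> \<longrightarrow>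
        (\<Sum>i<n. u (c i) (d i)) < e')" for u \<eta>
  obtain \<eta>1 where \<eta>1: "0 < \<eta>1" "small (\<lambda>s t. norm (G t - G s)) \<eta>1"
    using G \<open>0 < e'\<close> unfolding abs_continuous_on_interval_def small_def by blast
  obtain \<eta>2 where \<eta>2: "0 < \<eta>2" "small (\<lambda>s t. norm (H t - H s)) \<eta>2"
    using H \<open>0 < e'\<close> unfolding abs_continuous_on_interval_def small_def by blast
  have "(\<Sum>i<n. norm (F (d i) - F (c i))) < e"
    if cd: "(\<forall>i<n. a \<le> c i \<and> c i \<le> d i \<and> d i \<le> b) \<and>
        disjoint_family_on (\<lambda>i. {c i<..<d i}) {..<n} \<and> (\<Sum>i<n. d i - c i) < min \<eta>1 \<eta>2"
    for n :: nat and c d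
  proof -
    have 1: "(\<Sum>i<n. norm (G (d i) - G (c i))) < e'"
      using \<eta>1(2) cd unfolding small_def by auto
    have 2: "(\<Sum>i<n. norm (H (d i) - H (c i))) < e'"
      using \<eta>2(2) cd unfolding small_def by auto
    have "(\<Sum>i<n. norm (F (d i) - F (c i))) \<le>
        (\<Sum>i<n. L * (norm (G (d i) - G (c i)) + norm (H (d i) - H (c i))))"
    proof (rule sum_mono)
      fix i assume "i \<in> {..<n}"
      then have "norm (F (d i) - F (c i)) \<le> M * (norm (G (d i) - G (c i)) + norm (H (d i) - H (c i)))"
        using cd by (intro dom) auto
      also have "\<dots> \<le> L * (norm (G (d i) - G (c i)) + norm (H (d i) - H (c i)))"
        using \<open>M \<le> L\<close> by (intro mult_right_mono) auto
      finally show "norm (F (d i) - F (c i)) \<le> \<dots>" .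
    qed
    also have "\<dots> = L * ((\<Sum>i<n. norm (G (d i) - G (c i))) + (\<Sum>i<n. norm (H (d i) - H (c i))))"
      by (simp add: sum_distrib_left sum.distrib distrib_left)
    also have "\<dots> < L * (e' + e')"
      using 1 2 \<open>0 < L\<close> by (intro mult_strict_left_mono) auto
    also have "\<dots> = e"
      using \<open>0 < L\<close> by (simp add: e'_def)
    finally show ?thesis .
  qed
  then show "\<exists>\<eta>>0. \<forall>(n::nat) c d. (\<forall>i<n. a \<le> c i \<and> c i \<le> d i \<and> d i \<le> b) \<and>
        disjoint_family_on (\<lambda>i. {c i<..<d i}) {..<n} \<and> (\<Sum>i<n. d i - c i) < \<eta> \<longrightarrow>
        (\<Sum>i<n. norm (F (d i) - F (c i))) < e"
    using \<eta>1(1) \<eta>2(1) by (intro exI[of _ "min \<eta>1 \<eta>2"]) auto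
qed

lemma abs_continuous_lipschitz:
  assumes "\<And>s t. a \<le> s \<Longrightarrow> s \<le> t \<Longrightarrow> t \<le> b \<Longrightarrow> norm (F t - F s) \<le> M * (t - s)"
  shows "abs_continuous_on_interval F a b"
proof -
  have id: "abs_continuous_on_interval (\<lambda>t::real. t) a b"
    unfolding abs_continuous_on_interval_def
    by (intro allI impI exI conjI, assumption) (auto simp: abs_of_nonneg cong: sum.cong_simp)
  have "norm (F t - F s) \<le> M/2 * (norm (t - s) + norm (t - s))" if "a \<le> s" "s \<le> t" "t \<le> b" for s t
    using assms[OF that] that by (simp add: algebra_simps)
  then show ?thesis
    by (rule abs_continuous_dominated[OF id id])
qed

lemma abs_continuous_const: "abs_continuous_on_interval (\<lambda>t. c) a b"
  by (rule abs_continuous_lipschitz[of _ _ _ 0]) simp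

lemma abs_continuous_C1:
  assumes deriv: "\<And>t. t \<in> {a..b} \<Longrightarrow> (F has_real_derivative F' t) (at t)"
    and cont: "continuous_on {a..b} F'"
  shows "abs_continuous_on_interval F a b"
proof -
  obtain M where M: "\<And>t. t \<in> {a..b} \<Longrightarrow> norm (F' t) \<le> M"
    using compact_imp_bounded[OF compact_continuous_image[OF cont compact_Icc]]
    unfolding bounded_iff by blast
  have "norm (F t - F s) \<le> M * norm (t - s)" if "a \<le> s" "s \<le> t" "t \<le> b" for s t
    using that deriv
    by (intro field_differentiable_bound[of "{a..b}" F F'] M)
       (auto intro: has_field_derivative_at_within)
  then show ?thesis
    by (intro abs_continuous_lipschitz[of _ _ _ M]) fastforce
qed

lemma abs_continuous_powr:
  assumes "0 < a"
  shows "abs_continuous_on_interval (\<lambda>t. t powr q) a b"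
  using assms
  by (intro abs_continuous_C1[where F' = "\<lambda>t. q * t powr (q - 1)"])
     (auto intro!: continuous_intros has_real_derivative_powr)

lemma abs_continuous_add:
  assumes "abs_continuous_on_interval G a b" "abs_continuous_on_interval H a b"
  shows "abs_continuous_on_interval (\<lambda>t. G t + H t) a b"
  by (rule abs_continuous_dominated[OF assms, of _ 1]) (simp add: add_diff_add norm_triangle_ineq)

lemma abs_continuous_diff:
  assumes "abs_continuous_on_interval G a b" "abs_continuous_on_interval H a b"
  shows "abs_continuous_on_interval (\<lambda>t. G t - H t) a b"
proof (rule abs_continuous_dominated[OF assms, of _ 1])
  fix s t
  show "norm (G t - H t - (G s - H s)) \<le> 1 * (norm (G t - G s) + norm (H t - H s))"
    using norm_triangle_ineq4[of "G t - G s" "H t - H s"] by (simp add: algebra_simps)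
qed

lemma abs_continuous_Pair:
  assumes "abs_continuous_on_interval G a b" "abs_continuous_on_interval H a b"
  shows "abs_continuous_on_interval (\<lambda>t. (G t, H t)) a b"
  by (rule abs_continuous_dominated[OF assms, of _ 1]) (simp add: norm_Pair_le)

lemma abs_continuous_imp_bounded:
  assumes ac: "abs_continuous_on_interval G a b"
  obtains M where "0 \<le> M" "\<And>t. t \<in> {a..b} \<Longrightarrow> norm (G t) \<le> M"
proof -
  have "continuous_on {a..b} G"
    unfolding continuous_on_iff
  proof (intro ballI allI impI)
    fix t and e :: real assume t: "t \<in> {a..b}" and "0 < e"
    obtain \<eta> where "0 < \<eta>" and
      \<eta>: "\<And>(n::nat) c d. (\<forall>i<n. a \<le> c i \<and> c i \<le> d i \<and> d i \<le> b) \<and>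
        disjoint_family_on (\<lambda>i. {c i<..<d i}) {..<n} \<and> (\<Sum>i<n. d i - c i) < \<eta> \<Longrightarrow>
        (\<Sum>i<n. norm (G (d i) - G (c i))) < e"
      using ac \<open>0 < e\<close> unfolding abs_continuous_on_interval_def by meson
    have "dist (G s) (G t) < e" if "s \<in> {a..b}" "dist s t < \<eta>" for s
    proof -
      have "norm (G (max s t) - G (min s t)) < e"
        using \<eta>[of 1 "\<lambda>_. min s t" "\<lambda>_. max s t"] that t
        by (simp add: disjoint_family_on_def dist_real_def max_def min_def abs_less_iff split: if_splits)
      then show ?thesis
        by (auto simp: dist_norm max_def min_def norm_minus_commute split: if_splits)
    qed
    then show "\<exists>d>0. \<forall>s\<in>{a..b}. dist s t < d \<longrightarrow> dist (G s) (G t) < e"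
      using \<open>0 < \<eta>\<close> by blast
  qed
  then have "bounded (G ` {a..b})"
    by (intro compact_imp_bounded compact_continuous_image) auto
  then obtain M where "0 < M" "\<forall>x\<in>G ` {a..b}. norm x \<le> M"
    unfolding bounded_pos by blast
  then show ?thesis
    using that[of M] by simp
qed

lemma (in bounded_bilinear) abs_continuous:
  assumes G: "abs_continuous_on_interval G c d" and H: "abs_continuous_on_interval H c d"
  shows "abs_continuous_on_interval (\<lambda>t. prod (G t) (H t)) c d"
proof -
  obtain M1 where M1: "0 \<le> M1" "\<And>t. t \<in> {c..d} \<Longrightarrow> norm (G t) \<le> M1"
    by (rule abs_continuous_imp_bounded[OF G]) auto
  obtain M2 where M2: "0 \<le> M2" "\<And>t. t \<in> {c..d} \<Longrightarrow> norm (H t) \<le> M2"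
    by (rule abs_continuous_imp_bounded[OF H]) auto
  obtain K where K: "0 \<le> K" "\<And>x y. norm (prod x y) \<le> norm x * norm y * K"
    using nonneg_bounded by blast
  have "norm (prod (G t) (H t) - prod (G s) (H s)) \<le>
      ((M1 + M2) * K) * (norm (G t - G s) + norm (H t - H s))"
    if st: "c \<le> s" "s \<le> t" "t \<le> d" for s t
  proof -
    have "prod (G t) (H t) - prod (G s) (H s) = prod (G t - G s) (H t) + prod (G s) (H t - H s)"
      by (simp add: diff_left diff_right)
    also have "norm \<dots> \<le> norm (G t - G s) * norm (H t) * K + norm (G s) * norm (H t - H s) * K"
      using K(2) by (intro norm_triangle_mono)
    also have "\<dots> \<le> norm (G t - G s) * (M1 + M2) * K + (M1 + M2) * norm (H t - H s) * K"
      using st M1(1) M2(1) M1(2)[of s] M2(2)[of t] K(1)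
      by (intro add_mono mult_right_mono mult_left_mono) auto
    also have "\<dots> = ((M1 + M2) * K) * (norm (G t - G s) + norm (H t - H s))"
      by (simp add: algebra_simps)
    finally show ?thesis .
  qed
  then show ?thesis
    by (rule abs_continuous_dominated[OF G H])
qed

lemma abs_continuous_half_square_dist:
  fixes u :: "real \<Rightarrow> 'b::real_inner"
  assumes "abs_continuous_on_interval u a b"
  shows "abs_continuous_on_interval (\<lambda>t. (norm (u t - z))\<^sup>2 / 2) a b"
proof -
  have 1: "abs_continuous_on_interval (\<lambda>t. u t - z) a b"
    by (intro abs_continuous_diff abs_continuous_const assms)
  have "abs_continuous_on_interval (\<lambda>t. (1/2) * ((u t - z) \<bullet> (u t - z))) a b"
    by (intro bounded_bilinear.abs_continuous[OF bounded_bilinear_mult]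
        bounded_bilinear.abs_continuous[OF bounded_bilinear_inner] abs_continuous_const 1)
  then show ?thesis
    by (simp add: power2_norm_eq_inner)
qed

lemma has_derivative_half_square_dist:
  fixes u :: "real \<Rightarrow> 'b::real_inner"
  assumes "(u has_vector_derivative u') (at t)"
  shows "((\<lambda>t. (norm (u t - z))\<^sup>2 / 2) has_real_derivative u' \<bullet> (u t - z)) (at t)"
proof -
  have "((\<lambda>t. u t - z) has_vector_derivative u') (at t)"
    using assms by (auto intro!: derivative_eq_intros)
  from bounded_bilinear.has_vector_derivative[OF bounded_bilinear_inner this this]
  have "((\<lambda>t. (u t - z) \<bullet> (u t - z)) has_real_derivative 2 * (u' \<bullet> (u t - z))) (at t)"
    by (simp add: has_real_derivative_iff_has_vector_derivative inner_commute)
  from DERIV_cdivide[OF this, of 2] show ?thesis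
    by (simp add: power2_norm_eq_inner)
qed

section \<open>Differential inequalities of Euler type\<close>

text \<open>
  The inequality \<open>u' \<le> q / t * (c - u)\<close> says that \<open>t powr q * (u t - c)\<close> has a nonpositive derivative.
  This is Gronwall's lemma for the coefficient \<open>q / t\<close>.
\<close>

lemma euler_inequality_weighted_antimono:
  fixes u :: "real \<Rightarrow> real"
  assumes T: "0 < T" "T \<le> b" and ac: "abs_continuous_on_interval u T b"
    and deriv: "AE t in lborel. T \<le> t \<and> t \<le> b \<longrightarrow>
      (\<exists>u'. (u has_real_derivative u') (at t) \<and> u' \<le> q / t * (c - u t))"
  shows "b powr q * (u b - c) \<le> T powr q * (u T - c)"
proof -
  let ?w = "\<lambda>t. t powr q * (u t - c)"
  have cone: "convex_cone {..0::real}" "closed {..0::real}"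
    by (auto simp: convex_cone_iff mult_nonneg_nonpos)
  have acw: "abs_continuous_on_interval ?w T b"
    by (intro bounded_bilinear.abs_continuous[OF bounded_bilinear_mult] abs_continuous_powr
        abs_continuous_diff abs_continuous_const ac T)
  have "AE t in lborel. T \<le> t \<and> t \<le> b \<longrightarrow> (\<exists>d\<in>{..0}. (?w has_vector_derivative d) (at t))"
    using deriv
  proof (rule AE_mp[OF _ AE_I2], intro impI)
    fix t assume 1: "T \<le> t \<and> t \<le> b \<longrightarrow> (\<exists>u'. (u has_real_derivative u') (at t) \<and> u' \<le> q / t * (c - u t))"
      and 2: "T \<le> t \<and> t \<le> b"
    then obtain u' where u': "(u has_real_derivative u') (at t)" "u' \<le> q / t * (c - u t)"
      by blast
    have "0 < t" using T 2 by linarith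
    have "(?w has_real_derivative (q * t powr (q - 1) * (u t - c) + t powr q * u')) (at t)"
      using u'(1) \<open>0 < t\<close> by (auto intro!: derivative_eq_intros has_real_derivative_powr)
    moreover have "t powr q * u' \<le> t powr q * (q / t * (c - u t))"
      using u'(2) by (intro mult_left_mono) auto
    moreover have "t powr q * (q / t * (c - u t)) = - (q * t powr (q - 1) * (u t - c))"
      using \<open>0 < t\<close> by (simp add: powr_diff field_simps)
    ultimately show "\<exists>d\<in>{..0}. (?w has_vector_derivative d) (at t)"
      by (force simp: has_real_derivative_iff_has_vector_derivative)
  qed
  from increment_in_closed_convex_cone[OF T(2) acw cone this] show ?thesis
    by simp
qed

lemma euler_inequality_bounded:
  fixes u :: "real \<Rightarrow> real"
  assumes T: "0 < T" "T \<le> b" and ac: "abs_continuous_on_interval u T b"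
    and deriv: "AE t in lborel. T \<le> t \<and> t \<le> b \<longrightarrow>
      (\<exists>u'. (u has_real_derivative u') (at t) \<and> u' \<le> q / t * (c - u t))"
    and "0 \<le> q" "0 \<le> c" "0 \<le> u T"
  shows "u b \<le> c + u T"
proof -
  have "b powr q * (u b - c) \<le> T powr q * (u T - c)"
    by (rule euler_inequality_weighted_antimono[OF T ac deriv])
  also have "\<dots> \<le> T powr q * u T"
    using \<open>0 \<le> c\<close> by (intro mult_left_mono) auto
  also have "\<dots> \<le> b powr q * u T"
    using T \<open>0 \<le> q\<close> \<open>0 \<le> u T\<close> by (intro mult_right_mono powr_mono2) auto
  finally have "u b - c \<le> u T"
    using T by (simp add: mult_le_cancel_left)
  then show ?thesis by simp
qed

text \<open>
  The weight \<open>t powr q\<close> is unbounded, so the initial value is forgotten and \<open>u\<close> falls below every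
  \<open>\<eta>\<close> for which the inequality eventually holds.
\<close>

lemma euler_inequality_tendsto_zero:
  fixes u :: "real \<Rightarrow> real"
  assumes q: "0 < q" and nonneg: "\<And>t. 0 \<le> u t"
    and ac: "\<And>c d. t0 \<le> c \<Longrightarrow> c \<le> d \<Longrightarrow> abs_continuous_on_interval u c d"
    and deriv: "\<And>\<eta>. 0 < \<eta> \<Longrightarrow> \<exists>T. AE t in lborel. T \<le> t \<longrightarrow>
      (\<exists>u'. (u has_real_derivative u') (at t) \<and> u' \<le> q / t * (\<eta> - u t))"
  shows "(u \<longlongrightarrow> 0) at_top"
proof (rule tendstoI)
  fix e :: real assume "0 < e"
  then obtain T0 where T0: "AE t in lborel. T0 \<le> t \<longrightarrow>
      (\<exists>u'. (u has_real_derivative u') (at t) \<and> u' \<le> q / t * (e/2 - u t))"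
    using deriv[of "e/2"] by auto
  define T where "T = max 1 (max t0 T0)"
  define C where "C = T powr q * (u T - e/2)"
  have bound: "u t \<le> e/2 + C * t powr (-q)" if "T \<le> t" for t
  proof -
    have "AE s in lborel. T \<le> s \<and> s \<le> t \<longrightarrow>
        (\<exists>u'. (u has_real_derivative u') (at s) \<and> u' \<le> q / s * (e/2 - u s))"
      using T0 by (rule AE_mp) (auto simp: T_def intro!: AE_I2)
    then have "t powr q * (u t - e/2) \<le> C"
      unfolding C_def using that
      by (intro euler_inequality_weighted_antimono ac) (auto simp: T_def)
    then have "u t - e/2 \<le> C / t powr q"
      using that by (subst pos_le_divide_eq) (auto simp: T_def mult.commute)
    then show ?thesis
      by (simp add: powr_minus_divide)
  qed
  have "((\<lambda>t. t powr (-q)) \<longlongrightarrow> 0) at_top"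
    using q by (intro tendsto_neg_powr filterlim_ident) simp
  then have "((\<lambda>t. e/2 + C * t powr (-q)) \<longlongrightarrow> e/2 + C * 0) at_top"
    by (intro tendsto_add tendsto_mult tendsto_const)
  from order_tendstoD(2)[OF this, of e]
  have "\<forall>\<^sub>F t in at_top. e/2 + C * t powr (-q) < e"
    using \<open>0 < e\<close> by simp
  then show "\<forall>\<^sub>F t in at_top. dist (u t) 0 < e"
    using eventually_ge_at_top[of T]
  proof eventually_elim
    case (elim t)
    then show ?case
      using bound[of t] nonneg[of t] by (simp add: dist_real_def)
  qed
qed

section \<open>Nested convex sets and near minimizers\<close>

text \<open>
  The squared distances \<open>d n\<close> from the origin to \<open>C n\<close>
  increase to a limit; the midpoint of two almost shortest elements of \<open>C n\<close> cannot be shorter than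
  \<open>d n\<close>, so the parallelogram law makes these elements a Cauchy sequence.
\<close>

lemma nested_closed_convex_intersection:
  fixes C :: "nat \<Rightarrow> 'b::{real_inner, complete_space} set"
  assumes closed: "\<And>n. closed (C n)" and convex: "\<And>n. convex (C n)" and dec: "decseq C"
    and bound: "\<And>n. \<exists>y\<in>C n. (norm y)\<^sup>2 \<le> \<rho>"
  obtains y where "\<And>n. y \<in> C n" "(norm y)\<^sup>2 \<le> \<rho>"
proof -
  define d where "d n = Inf ((\<lambda>y. (norm y)\<^sup>2) ` C n)" for n
  have bdd: "bdd_below ((\<lambda>y. (norm y)\<^sup>2) ` C n)" for n
    by (rule bdd_belowI[of _ 0]) auto
  have ne: "C n \<noteq> {}" for n
    using bound by blast
  have d_le: "d n \<le> (norm y)\<^sup>2" if "y \<in> C n" for n y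
    unfolding d_def using that bdd by (intro cInf_lower) auto
  have d_\<rho>: "d n \<le> \<rho>" for n
    using bound[of n] d_le by (meson order_trans)
  have "incseq d"
    unfolding d_def using ne bdd dec
    by (intro monoI cInf_superset_mono image_mono) (auto simp: decseq_def)
  then obtain L where L: "d \<longlonglongrightarrow> L" "\<And>n. d n \<le> L"
    using d_\<rho> by (metis incseq_convergent)
  have "\<exists>y\<in>C n. (norm y)\<^sup>2 < d n + inverse (real (Suc n))" for n
    using cInf_lessD[of "(\<lambda>y. (norm y)\<^sup>2) ` C n" "d n + inverse (real (Suc n))"] ne
    by (auto simp: d_def)
  then obtain y where y: "\<And>n. y n \<in> C n" "\<And>n. (norm (y n))\<^sup>2 < d n + inverse (real (Suc n))"
    by metis
  have yC: "y k \<in> C n" if "n \<le> k" for n k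
    using y(1)[of k] dec that by (auto simp: decseq_def)
  define g where "g n = 2 * (L - d n) + 4 * inverse (real (Suc n))" for n
  have close: "(norm (y k - y n))\<^sup>2 \<le> g n" if "n \<le> k" for n k
  proof -
    have "(1/2) *\<^sub>R y k + (1/2) *\<^sub>R y n \<in> C n"
      using convexD[OF convex yC[OF that] y(1), of "1/2" "1/2"] by simp
    then have "d n \<le> (norm ((1/2) *\<^sub>R y k + (1/2) *\<^sub>R y n))\<^sup>2"
      by (rule d_le)
    also have "\<dots> = (norm (y k + y n))\<^sup>2 / 4"
      by (simp flip: scaleR_add_right add: power_divide)
    finally have "4 * d n \<le> (norm (y k + y n))\<^sup>2"
      by simp
    moreover have "(norm (y k - y n))\<^sup>2 + (norm (y k + y n))\<^sup>2 = 2 * (norm (y k))\<^sup>2 + 2 * (norm (y n))\<^sup>2"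
      by (simp add: power2_norm_eq_inner algebra_simps inner_commute)
    moreover have "inverse (real (Suc k)) \<le> inverse (real (Suc n))"
      using that by (simp add: field_simps)
    ultimately show ?thesis
      using y(2)[of k] y(2)[of n] L(2)[of k] unfolding g_def by argo
  qed
  have "g \<longlonglongrightarrow> 2 * (L - L) + 4 * 0"
    unfolding g_def
    by (intro tendsto_add tendsto_diff tendsto_mult tendsto_const L(1) LIMSEQ_inverse_real_of_nat)
  then have g0: "g \<longlonglongrightarrow> 0"
    by simp
  have "Cauchy y"
  proof (rule metric_CauchyI)
    fix e :: real assume "0 < e"
    then have "\<forall>\<^sub>F n in sequentially. g n < (e/2)\<^sup>2"
      by (intro order_tendstoD(2)[OF g0]) auto
    then obtain n where n: "g n < (e/2)\<^sup>2"
      by (auto simp: eventually_sequentially)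
    have "dist (y k) (y n) < e/2" if "n \<le> k" for k
    proof -
      have "(norm (y k - y n))\<^sup>2 < (e/2)\<^sup>2"
        using close[OF that] n by linarith
      then show ?thesis
        unfolding dist_norm by (rule power2_less_imp_less) (use \<open>0 < e\<close> in simp)
    qed
    then show "\<exists>M. \<forall>m\<ge>M. \<forall>n\<ge>M. dist (y m) (y n) < e"
      by (intro exI[of _ n] allI impI) (rule dist_triangle_half_l)
  qed
  then obtain l where l: "y \<longlonglongrightarrow> l"
    using Cauchy_convergent convergent_def by blast
  have "l \<in> C n" for n
  proof (rule Lim_in_closed_set[OF closed _ _ l])
    show "\<forall>\<^sub>F k in sequentially. y k \<in> C n"
      using eventually_ge_at_top[of n] by eventually_elim (rule yC)
  qed simp
  moreover have "(norm l)\<^sup>2 \<le> \<rho>"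
  proof (rule LIMSEQ_le)
    show "(\<lambda>n. (norm (y n))\<^sup>2) \<longlonglongrightarrow> (norm l)\<^sup>2"
      by (intro tendsto_intros l)
    have "(\<lambda>n. \<rho> + inverse (real (Suc n))) \<longlonglongrightarrow> \<rho> + 0"
      by (intro tendsto_add tendsto_const LIMSEQ_inverse_real_of_nat)
    then show "(\<lambda>n. \<rho> + inverse (real (Suc n))) \<longlonglongrightarrow> \<rho>"
      by simp
    have "(norm (y n))\<^sup>2 \<le> \<rho> + inverse (real (Suc n))" for n
      using y(2)[of n] d_\<rho>[of n] by linarith
    then show "\<exists>N. \<forall>n\<ge>N. (norm (y n))\<^sup>2 \<le> \<rho> + inverse (real (Suc n))"
      by blast
  qed
  ultimately show ?thesis
    by (rule that)
qed

text \<open>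
  Only points with finite second coordinate, so that the epigraph lives in a vector space.
\<close>

definition epigraph_of :: "('b \<Rightarrow> ereal) \<Rightarrow> ('b \<times> real) set" where
  "epigraph_of f = {(y, r). f y \<le> ereal r}"

lemma convex_epigraph_of:
  assumes "ereal_convex f"
  shows "convex (epigraph_of f)"
  unfolding convex_alt
proof (intro ballI allI impI)
  fix p q and s :: real
  assume "p \<in> epigraph_of f" "q \<in> epigraph_of f" and s: "0 \<le> s \<and> s \<le> 1"
  then obtain x r y r' where p: "p = (x, r)" "f x \<le> ereal r" and q: "q = (y, r')" "f y \<le> ereal r'"
    by (auto simp: epigraph_of_def)
  have "f ((1 - s) *\<^sub>R x + s *\<^sub>R y) \<le> ereal (1 - s) * f x + ereal s * f y"
    using assms s by (simp add: ereal_convex_def)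
  also have "\<dots> \<le> ereal (1 - s) * ereal r + ereal s * ereal r'"
    using s p q by (intro add_mono ereal_mult_left_mono) auto
  finally show "(1 - s) *\<^sub>R p + s *\<^sub>R q \<in> epigraph_of f"
    using p q by (simp add: epigraph_of_def)
qed

lemma closed_epigraph_of:
  fixes f :: "'b::first_countable_topology \<Rightarrow> ereal"
  assumes "lower_semicontinuous f"
  shows "closed (epigraph_of f)"
  unfolding closed_sequential_limits
proof (intro allI impI, elim conjE)
  fix p l assume p: "\<forall>n. p n \<in> epigraph_of f" and lim: "p \<longlonglongrightarrow> l"
  show "l \<in> epigraph_of f"
  proof (rule ccontr)
    assume "l \<notin> epigraph_of f"
    then have "ereal (snd l) < f (fst l)"
      by (auto simp: epigraph_of_def)
    then obtain c where c: "ereal (snd l) < ereal c" "ereal c < f (fst l)"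
      using ereal_dense2 by blast
    have "ereal c < Liminf (nhds (fst l)) f"
      using assms c(2) by (meson lower_semicontinuous_def less_le_trans)
    then have "\<forall>\<^sub>F y in nhds (fst l). ereal c < f y"
      by (rule less_LiminfD)
    then have "\<forall>\<^sub>F n in sequentially. ereal c < f (fst (p n))"
      using tendsto_fst[OF lim] by (rule eventually_compose_filterlim)
    moreover have "\<forall>\<^sub>F n in sequentially. snd (p n) < c"
      using c(1) by (intro order_tendstoD(2)[OF tendsto_snd[OF lim]]) auto
    ultimately have "\<forall>\<^sub>F n in sequentially. False"
    proof eventually_elim
      case (elim n)
      have "f (fst (p n)) \<le> ereal (snd (p n))"
        using p by (auto simp: epigraph_of_def case_prod_beta)
      also have "\<dots> < ereal c"
        using elim by simp
      finally show False
        using elim by (simp add: order.strict_iff_not)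
    qed
    then show False by simp
  qed
qed

text \<open>
  The quantitative form of the least norm property of \<open>xs\<close>. If it failed, every sublevel set of \<open>f\<close>
  above the minimum would contain an element whose squared norm is below that of \<open>xs\<close> by \<open>\<eta>\<close>, and so
  would their intersection, which is the set of minimizers.
\<close>

lemma min_norm_of_near_minimizers:
  fixes f :: "'b::{real_inner, complete_space} \<Rightarrow> ereal"
  assumes cvx: "ereal_convex f" and lsc: "lower_semicontinuous f"
    and m: "\<And>y. ereal m \<le> f y"
    and xs: "\<And>y. f y = ereal m \<Longrightarrow> norm xs \<le> norm y"
    and "0 < \<eta>"
  shows "\<exists>r>0. \<forall>y. f y \<le> ereal (m + r) \<longrightarrow> (norm xs)\<^sup>2 - \<eta> \<le> (norm y)\<^sup>2"
proof (rule ccontr)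
  assume neg: "\<not> ?thesis"
  define C where "C n = {y. f y \<le> ereal (m + inverse (real (Suc n)))}" for n
  have C: "C n = (\<lambda>y. (y, m + inverse (real (Suc n)))) -` epigraph_of f" for n
    by (auto simp: C_def epigraph_of_def)
  have "closed (C n)" for n
    unfolding C by (intro closed_vimage closed_epigraph_of lsc continuous_intros)
  moreover have "convex (C n)" for n
    unfolding convex_alt
  proof (intro ballI allI impI)
    fix x y and s :: real assume xy: "x \<in> C n" "y \<in> C n" and s: "0 \<le> s \<and> s \<le> 1"
    then have "(1 - s) *\<^sub>R (x, m + inverse (real (Suc n))) + s *\<^sub>R (y, m + inverse (real (Suc n))) \<in> epigraph_of f"
      using convex_epigraph_of[OF cvx] unfolding convex_alt C by blast
    then show "(1 - s) *\<^sub>R x + s *\<^sub>R y \<in> C n"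
      by (simp add: C algebra_simps)
  qed
  moreover have "decseq C"
    unfolding decseq_def
  proof (intro allI impI subsetI)
    fix n k :: nat and x assume "n \<le> k" "x \<in> C k"
    then have "f x \<le> ereal (m + inverse (real (Suc k)))"
      by (simp add: C_def)
    also have "\<dots> \<le> ereal (m + inverse (real (Suc n)))"
      using \<open>n \<le> k\<close> by (simp add: field_simps)
    finally show "x \<in> C n"
      by (simp add: C_def)
  qed
  moreover have "\<exists>y\<in>C n. (norm y)\<^sup>2 \<le> (norm xs)\<^sup>2 - \<eta>" for n
    using neg[simplified, rule_format, of "inverse (real (Suc n))"] by (force simp: C_def)
  ultimately obtain y where y: "\<And>n. y \<in> C n" "(norm y)\<^sup>2 \<le> (norm xs)\<^sup>2 - \<eta>"
    by (rule nested_closed_convex_intersection) auto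
  have "f y \<le> ereal m"
  proof (rule LIMSEQ_le_const)
    have "(\<lambda>n. m + inverse (real (Suc n))) \<longlonglongrightarrow> m + 0"
      by (intro tendsto_add tendsto_const LIMSEQ_inverse_real_of_nat)
    then show "(\<lambda>n. ereal (m + inverse (real (Suc n)))) \<longlonglongrightarrow> ereal m"
      by simp
  qed (use y(1) in \<open>auto simp: C_def\<close>)
  then have "norm xs \<le> norm y"
    using m[of y] by (intro xs antisym)
  then have "(norm xs)\<^sup>2 \<le> (norm y)\<^sup>2"
    by simp
  then show False
    using y(2) \<open>0 < \<eta>\<close> by linarith
qed

section \<open>Jensen's inequality for absolutely continuous averages\<close>

text \<open>
  The closed cone over the epigraph placed at height \<open>1\<close>. At heights \<open>c > 0\<close> it is the epigraph of
  the perspective function \<open>(c, w) \<mapsto> c * f (w / c)\<close>; the closure adds the recession directions at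
  height \<open>0\<close>, and lower semicontinuity ensures that it adds nothing else.
\<close>

definition perspective_cone :: "('b::real_normed_vector \<Rightarrow> ereal) \<Rightarrow> (real \<times> 'b \<times> real) set" where
  "perspective_cone f = closure (conic hull ({1} \<times> epigraph_of f))"

lemma perspective_coneI:
  assumes "0 < c" "f (w /\<^sub>R c) \<le> ereal (r / c)"
  shows "(c, w, r) \<in> perspective_cone f"
proof -
  have "(c, w, r) = c *\<^sub>R (1, w /\<^sub>R c, r / c)"
    using \<open>0 < c\<close> by simp
  also have "\<dots> \<in> conic hull ({1} \<times> epigraph_of f)"
    using assms by (intro conic_mul conic_conic_hull hull_inc) (auto simp: epigraph_of_def)
  finally show ?thesis
    unfolding perspective_cone_def using closure_subset by blast
qed

lemma perspective_coneD:
  assumes lsc: "lower_semicontinuous f" and mem: "(c, w, r) \<in> perspective_cone f" and "0 < c"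
  shows "f (w /\<^sub>R c) \<le> ereal (r / c)"
proof -
  obtain z where z: "\<And>n. z n \<in> conic hull ({1} \<times> epigraph_of f)" "z \<longlonglongrightarrow> (c, w, r)"
    using mem unfolding perspective_cone_def closure_sequential by blast
  have fst_lim: "(\<lambda>n. fst (z n)) \<longlonglongrightarrow> c" and snd_lim: "(\<lambda>n. snd (z n)) \<longlonglongrightarrow> (w, r)"
    using tendsto_fst[OF z(2)] tendsto_snd[OF z(2)] by auto
  have "(\<lambda>n. snd (z n) /\<^sub>R fst (z n)) \<longlonglongrightarrow> (w, r) /\<^sub>R c"
    using \<open>0 < c\<close> by (intro tendsto_scaleR tendsto_inverse fst_lim snd_lim) auto
  moreover have "\<forall>\<^sub>F n in sequentially. snd (z n) /\<^sub>R fst (z n) \<in> epigraph_of f"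
    using order_tendstoD(1)[OF fst_lim \<open>0 < c\<close>]
  proof eventually_elim
    case (elim n)
    obtain k p where "z n = k *\<^sub>R (1, p)" "p \<in> epigraph_of f"
      using z(1)[of n] unfolding conic_hull_explicit by blast
    then show ?case
      using elim by auto
  qed
  ultimately have "(w, r) /\<^sub>R c \<in> epigraph_of f"
    by (intro Lim_in_closed_set[OF closed_epigraph_of[OF lsc]]) auto
  then show ?thesis
    by (simp add: epigraph_of_def divide_inverse mult.commute)
qed

lemma convex_cone_closure:
  fixes S :: "'b::real_normed_vector set"
  assumes "convex_cone S"
  shows "convex_cone (closure S)"
  unfolding convex_cone_def conic_def
proof (intro conjI allI impI)
  show "closure S \<noteq> {}" "convex (closure S)"
    using assms by (auto simp: convex_cone_def)
  fix x and c :: real assume "x \<in> closure S" "0 \<le> c"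
  moreover have "(*\<^sub>R) c ` S \<subseteq> S"
    using assms \<open>0 \<le> c\<close> by (auto intro: convex_cone_scaleR)
  ultimately show "c *\<^sub>R x \<in> closure S"
    using closure_mono[of "(*\<^sub>R) c ` S" S] closure_scaleR[of c S] by blast
qed

lemma convex_cone_perspective_cone:
  assumes "ereal_convex f" "epigraph_of f \<noteq> {}"
  shows "convex_cone (perspective_cone f)"
proof -
  have "convex_cone (conic hull ({1::real} \<times> epigraph_of f))"
    unfolding convex_cone_def
  proof (intro conjI conic_conic_hull convex_conic_hull convex_Times convex_epigraph_of assms(1))
    have "{1::real} \<times> epigraph_of f \<noteq> {}"
      using assms(2) by simp
    then show "conic hull ({1::real} \<times> epigraph_of f) \<noteq> {}"
      using hull_subset[of "{1::real} \<times> epigraph_of f" conic] by blast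
  qed simp
  then show ?thesis
    unfolding perspective_cone_def by (rule convex_cone_closure)
qed

text \<open>
  Jensen's inequality in differential form: \<open>c\<close> is an accumulated weight, \<open>X\<close> an accumulated weighted
  sum of points and \<open>R\<close> an accumulated bound on the weighted sum of values. The hypothesis on the
  derivatives says that the curve \<open>(c, X, R)\<close> moves in directions of the perspective cone.
\<close>

lemma convex_function_of_average:
  fixes f :: "'b::real_normed_vector \<Rightarrow> ereal" and c R :: "real \<Rightarrow> real" and X :: "real \<Rightarrow> 'b"
  assumes cvx: "ereal_convex f" and lsc: "lower_semicontinuous f" and "a \<le> b"
    and ac: "abs_continuous_on_interval (\<lambda>t. (c t, X t, R t)) a b"
    and deriv: "AE t in lborel. a \<le> t \<and> t \<le> b \<longrightarrow> (\<exists>c' X' R'.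
       (c has_vector_derivative c') (at t) \<and> (X has_vector_derivative X') (at t) \<and>
       (R has_vector_derivative R') (at t) \<and> 0 < c' \<and> f (X' /\<^sub>R c') \<le> ereal (R' / c'))"
    and start: "0 < c a" "f (X a /\<^sub>R c a) \<le> ereal (R a / c a)" and "0 < c b"
  shows "f (X b /\<^sub>R c b) \<le> ereal (R b / c b)"
proof -
  let ?u = "\<lambda>t. (c t, X t, R t)"
  have "epigraph_of f \<noteq> {}"
    using start(2) by (auto simp: epigraph_of_def)
  then have cone: "convex_cone (perspective_cone f)"
    using cvx by (rule convex_cone_perspective_cone[rotated])
  have closed: "closed (perspective_cone f)"
    by (simp add: perspective_cone_def)
  have "AE t in lborel. a \<le> t \<and> t \<le> b \<longrightarrow>
      (\<exists>d\<in>perspective_cone f. (?u has_vector_derivative d) (at t))"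
    using deriv
  proof (rule AE_mp, intro AE_I2 impI)
    fix t assume "a \<le> t \<and> t \<le> b \<longrightarrow> (\<exists>c' X' R'.
       (c has_vector_derivative c') (at t) \<and> (X has_vector_derivative X') (at t) \<and>
       (R has_vector_derivative R') (at t) \<and> 0 < c' \<and> f (X' /\<^sub>R c') \<le> ereal (R' / c'))"
      and "a \<le> t \<and> t \<le> b"
    then obtain c' X' R' where "(c has_vector_derivative c') (at t)"
      "(X has_vector_derivative X') (at t)" "(R has_vector_derivative R') (at t)"
      and "0 < c'" "f (X' /\<^sub>R c') \<le> ereal (R' / c')"
      by blast
    then show "\<exists>d\<in>perspective_cone f. (?u has_vector_derivative d) (at t)"
      by (intro bexI[of _ "(c', X', R')"] has_vector_derivative_Pair perspective_coneI)
  qed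
  from increment_in_closed_convex_cone[OF \<open>a \<le> b\<close> ac cone closed this]
  have "?u b - ?u a \<in> perspective_cone f" .
  moreover have "?u a \<in> perspective_cone f"
    using start by (rule perspective_coneI)
  ultimately have "?u b - ?u a + ?u a \<in> perspective_cone f"
    by (rule convex_cone_add[OF cone])
  then show ?thesis
    using \<open>0 < c b\<close> by (intro perspective_coneD[OF lsc]) simp_all
qed

section \<open>The regularized trajectory\<close>

text \<open>
  The regularized flow with the data of the minimization problem reduced to what the estimates use:
  the real minimum \<open>m\<close> and its attainment at a point \<open>z\<close> of least norm.
\<close>

locale regularized_descent =
  fixes f :: "'a::{real_inner, complete_space} \<Rightarrow> ereal" and \<alpha> \<delta> t0 m :: real
    and z :: 'a and v x :: "real \<Rightarrow> 'a"
  assumes \<alpha>: "3 < \<alpha>" and \<delta>: "0 < \<delta>" and t0: "0 < t0"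
    and cvx: "ereal_convex f" and lsc: "lower_semicontinuous f"
    and lower_bound: "\<And>y. ereal m \<le> f y" and minimizer: "f z = ereal m"
    and least_norm: "\<And>y. f y = ereal m \<Longrightarrow> norm z \<le> norm y"
    and solution: "strong_solution f \<alpha> \<delta> t0 v x"
    and start_in_domain: "f (x t0) < \<infinity>"
begin

definition \<theta> :: "real \<Rightarrow> real" where "\<theta> t = (norm (v t - z))\<^sup>2 / 2"

lemma \<theta>_nonneg: "0 \<le> \<theta> t"
  by (simp add: \<theta>_def)

lemma double_\<theta>: "2 * \<theta> t = (norm (v t - z))\<^sup>2"
  by (simp add: \<theta>_def)

lemma
  assumes "t0 \<le> c" "c \<le> d"
  shows abs_continuous_v: "abs_continuous_on_interval v c d"
    and abs_continuous_x: "abs_continuous_on_interval x c d"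
    and abs_continuous_\<theta>: "abs_continuous_on_interval \<theta> c d"
proof -
  show v: "abs_continuous_on_interval v c d" and "abs_continuous_on_interval x c d"
    using solution assms by (auto simp: strong_solution_def)
  show "abs_continuous_on_interval \<theta> c d"
    unfolding \<theta>_def by (rule abs_continuous_half_square_dist[OF v])
qed

text \<open>
  The estimate from which both conclusions follow, stated at a single time; \<open>\<phi>\<close> is the value
  \<open>f (v t)\<close> as a real number.
\<close>

definition energy_at :: "real \<Rightarrow> bool" where
  "energy_at t \<longleftrightarrow> (\<exists>\<theta>' x' \<phi>.
     (\<theta> has_real_derivative \<theta>') (at t) \<and> (x has_vector_derivative x') (at t) \<and>
     x' = ((\<alpha> - 1) / t) *\<^sub>R (v t - x t) \<and> f (v t) = ereal \<phi> \<and> m \<le> \<phi> \<and>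
     t / (\<alpha> - 1) * (\<phi> - m) \<le> - \<theta>' - \<delta> / t * ((norm (v t))\<^sup>2 + 2 * \<theta> t - (norm z)\<^sup>2))"

text \<open>
  The subgradient inequality at \<open>v t\<close>, evaluated at \<open>z\<close>, bounds the decrease of \<open>\<theta>\<close> from below; the term
  \<open>v \<bullet> (v - z)\<close> caused by the regularization is rewritten by polarization. The same
  inequality shows that \<open>f (v t)\<close> is finite.
\<close>

lemma energy_inequality:
  "AE t in lborel. t0 \<le> t \<longrightarrow> energy_at t"
proof -
  have "AE t in lborel. t0 \<le> t \<longrightarrow>
        (\<exists>v' x'. (v has_vector_derivative v') (at t) \<and> (x has_vector_derivative x') (at t) \<and>
           0 \<in> (\<lambda>g. v' + (t / (\<alpha> - 1)) *\<^sub>R g + (2 * \<delta> / t) *\<^sub>R v t) ` subdifferential f (v t) \<and>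
           x' + ((\<alpha> - 1) / t) *\<^sub>R (x t - v t) = 0)"
    using solution by (simp add: strong_solution_def)
  then show ?thesis
  proof (rule AE_mp, intro AE_I2 impI)
    fix t
    assume "t0 \<le> t \<longrightarrow>
        (\<exists>v' x'. (v has_vector_derivative v') (at t) \<and> (x has_vector_derivative x') (at t) \<and>
           0 \<in> (\<lambda>g. v' + (t / (\<alpha> - 1)) *\<^sub>R g + (2 * \<delta> / t) *\<^sub>R v t) ` subdifferential f (v t) \<and>
           x' + ((\<alpha> - 1) / t) *\<^sub>R (x t - v t) = 0)" and t: "t0 \<le> t"
    then obtain v' x' g where v': "(v has_vector_derivative v') (at t)"
      and x': "(x has_vector_derivative x') (at t)" "x' + ((\<alpha> - 1) / t) *\<^sub>R (x t - v t) = 0"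
      and g: "g \<in> subdifferential f (v t)" "v' + (t / (\<alpha> - 1)) *\<^sub>R g + (2 * \<delta> / t) *\<^sub>R v t = 0"
      by (metis (no_types, lifting) image_iff)
    have "f (v t) + ereal (g \<bullet> (z - v t)) \<le> ereal m"
      using g(1) minimizer by (metis (mono_tags, lifting) mem_Collect_eq subdifferential_def)
    moreover have "ereal m \<le> f (v t)"
      by (rule lower_bound)
    ultimately obtain \<phi> where \<phi>: "f (v t) = ereal \<phi>" "m \<le> \<phi>" "\<phi> + g \<bullet> (z - v t) \<le> m"
      by (cases "f (v t)") auto
    have \<theta>': "(\<theta> has_real_derivative v' \<bullet> (v t - z)) (at t)"
      unfolding \<theta>_def by (rule has_derivative_half_square_dist[OF v'])
    have "t > 0" using t t0 by linarith
    have "v' = - ((t / (\<alpha> - 1)) *\<^sub>R g + (2 * \<delta> / t) *\<^sub>R v t)"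
      using g(2) by (simp only: add.assoc eq_neg_iff_add_eq_0)
    then have "v' \<bullet> (v t - z) = - ((t / (\<alpha> - 1)) *\<^sub>R g + (2 * \<delta> / t) *\<^sub>R v t) \<bullet> (v t - z)"
      by (rule arg_cong)
    also have "\<dots> = t / (\<alpha> - 1) * (g \<bullet> (z - v t)) - \<delta> / t * (2 * (v t \<bullet> (v t - z)))"
      by (simp add: algebra_simps)
    finally have "v' \<bullet> (v t - z) = t / (\<alpha> - 1) * (g \<bullet> (z - v t)) - \<delta> / t * (2 * (v t \<bullet> (v t - z)))" .
    moreover have "2 * (v t \<bullet> (v t - z)) = (norm (v t))\<^sup>2 + 2 * \<theta> t - (norm z)\<^sup>2"
      unfolding double_\<theta> by (simp add: power2_norm_eq_inner algebra_simps inner_commute)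
    moreover have "t / (\<alpha> - 1) * (\<phi> - m) \<le> t / (\<alpha> - 1) * (- (g \<bullet> (z - v t)))"
      using \<phi>(3) \<open>t > 0\<close> \<alpha> by (intro mult_left_mono) auto
    ultimately have "t / (\<alpha> - 1) * (\<phi> - m) \<le>
        - (v' \<bullet> (v t - z)) - \<delta> / t * ((norm (v t))\<^sup>2 + 2 * \<theta> t - (norm z)\<^sup>2)"
      by simp
    moreover have "x' = ((\<alpha> - 1) / t) *\<^sub>R (v t - x t)"
      using x'(2) by (simp add: eq_neg_iff_add_eq_0 algebra_simps)
    ultimately show "energy_at t"
      using \<theta>' x'(1) \<phi>(1,2) unfolding energy_at_def by blast
  qed
qed

lemma \<theta>_bounded:
  assumes "t0 \<le> b"
  shows "\<theta> b \<le> (norm z)\<^sup>2 / 2 + \<theta> t0"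
proof -
  have "AE t in lborel. t0 \<le> t \<and> t \<le> b \<longrightarrow> (\<exists>\<theta>'. (\<theta> has_real_derivative \<theta>') (at t) \<and>
      \<theta>' \<le> 2 * \<delta> / t * ((norm z)\<^sup>2 / 2 - \<theta> t))"
    using energy_inequality
  proof (rule AE_mp, intro AE_I2 impI)
    fix t
    assume "t0 \<le> t \<longrightarrow> energy_at t"
      and t: "t0 \<le> t \<and> t \<le> b"
    then obtain \<theta>' \<phi> where \<theta>': "(\<theta> has_real_derivative \<theta>') (at t)" and "m \<le> \<phi>"
      and *: "t / (\<alpha> - 1) * (\<phi> - m) \<le> - \<theta>' - \<delta> / t * ((norm (v t))\<^sup>2 + 2 * \<theta> t - (norm z)\<^sup>2)"
      unfolding energy_at_def by blast
    have "0 \<le> t / (\<alpha> - 1) * (\<phi> - m)" "0 \<le> \<delta> / t * (norm (v t))\<^sup>2"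
      using t t0 \<alpha> \<delta> \<open>m \<le> \<phi>\<close> by auto
    then have "\<theta>' \<le> 2 * \<delta> / t * ((norm z)\<^sup>2 / 2 - \<theta> t)"
      using * by (simp add: algebra_simps)
    then show "\<exists>\<theta>'. (\<theta> has_real_derivative \<theta>') (at t) \<and> \<theta>' \<le> 2 * \<delta> / t * ((norm z)\<^sup>2 / 2 - \<theta> t)"
      using \<theta>' by blast
  qed
  then show ?thesis
    using assms \<delta> by (intro euler_inequality_bounded[OF t0]) (auto intro: abs_continuous_\<theta> \<theta>_nonneg)
qed

text \<open>
  If \<open>f (v t)\<close> is close to \<open>m\<close>, the norm of \<open>v t\<close> is not much smaller than that of \<open>z\<close>; otherwise the
  descent term dominates as soon as \<open>t\<close> is large.
\<close>

lemma \<theta>_tendsto_0: "(\<theta> \<longlongrightarrow> 0) at_top"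
proof (rule euler_inequality_tendsto_zero[of "2 * \<delta>"])
  fix \<eta> :: real assume "0 < \<eta>"
  obtain r where "0 < r"
    and r: "\<And>y. f y \<le> ereal (m + r) \<Longrightarrow> (norm z)\<^sup>2 - 2 * \<eta> \<le> (norm y)\<^sup>2"
    using min_norm_of_near_minimizers[OF cvx lsc lower_bound least_norm, of "2 * \<eta>"] \<open>0 < \<eta>\<close> by auto
  \<comment> \<open>From \<open>T\<close> on, a value gap of \<open>r\<close> outweighs the term \<open>\<delta> / t * (norm z)\<^sup>2\<close>.\<close>
  define T where "T = max (max t0 1) ((\<alpha> - 1) * \<delta> * (norm z)\<^sup>2 / r)"
  have "AE t in lborel. T \<le> t \<longrightarrow>
      (\<exists>\<theta>'. (\<theta> has_real_derivative \<theta>') (at t) \<and> \<theta>' \<le> 2 * \<delta> / t * (\<eta> - \<theta> t))"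
    using energy_inequality
  proof (rule AE_mp, intro AE_I2 impI)
    fix t
    assume 1: "t0 \<le> t \<longrightarrow> energy_at t"
      and "T \<le> t"
    then have t: "t0 \<le> t" "1 \<le> t" "(\<alpha> - 1) * \<delta> * (norm z)\<^sup>2 / r \<le> t"
      by (auto simp: T_def)
    obtain \<theta>' \<phi> where \<theta>': "(\<theta> has_real_derivative \<theta>') (at t)" and \<phi>: "f (v t) = ereal \<phi>" "m \<le> \<phi>"
      and *: "t / (\<alpha> - 1) * (\<phi> - m) \<le> - \<theta>' - \<delta> / t * ((norm (v t))\<^sup>2 + 2 * \<theta> t - (norm z)\<^sup>2)"
      using 1 t(1) unfolding energy_at_def by blast
    have "\<delta> / t * ((norm z)\<^sup>2 - 2 * \<eta> - (norm (v t))\<^sup>2) \<le> t / (\<alpha> - 1) * (\<phi> - m)"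
    proof (cases "\<phi> \<le> m + r")
      case True
      then have "\<delta> / t * ((norm z)\<^sup>2 - 2 * \<eta> - (norm (v t))\<^sup>2) \<le> 0"
        using r[of "v t"] \<phi>(1) t(2) \<delta> by (intro mult_nonneg_nonpos) auto
      also have "0 \<le> t / (\<alpha> - 1) * (\<phi> - m)"
        using t(2) \<alpha> \<phi>(2) by auto
      finally show ?thesis .
    next
      case False
      have "\<delta> / t * ((norm z)\<^sup>2 - 2 * \<eta> - (norm (v t))\<^sup>2) \<le> \<delta> / t * (norm z)\<^sup>2"
        using t(2) \<delta> \<open>0 < \<eta>\<close> by (intro mult_left_mono) (auto intro: order_trans[of _ 0])
      also have "\<dots> \<le> \<delta> * (norm z)\<^sup>2"
        using t(2) \<delta> by (intro mult_right_mono) (auto simp: divide_le_eq mult_le_cancel_left1)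
      also have "\<dots> \<le> t / (\<alpha> - 1) * r"
        using t(3) \<open>0 < r\<close> \<alpha> by (simp add: field_simps)
      also have "\<dots> \<le> t / (\<alpha> - 1) * (\<phi> - m)"
        using False t(2) \<alpha> by (intro mult_left_mono) auto
      finally show ?thesis .
    qed
    moreover have "2 * \<delta> / t * (\<eta> - \<theta> t) =
        - (\<delta> / t * ((norm (v t))\<^sup>2 + 2 * \<theta> t - (norm z)\<^sup>2)) -
        \<delta> / t * ((norm z)\<^sup>2 - 2 * \<eta> - (norm (v t))\<^sup>2)"
      using t(2) by (simp add: field_simps)
    ultimately have "\<theta>' \<le> 2 * \<delta> / t * (\<eta> - \<theta> t)"
      using * by linarith
    then show "\<exists>\<theta>'. (\<theta> has_real_derivative \<theta>') (at t) \<and> \<theta>' \<le> 2 * \<delta> / t * (\<eta> - \<theta> t)"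
      using \<theta>' by blast
  qed
  then show "\<exists>T. AE t in lborel. T \<le> t \<longrightarrow>
      (\<exists>\<theta>'. (\<theta> has_real_derivative \<theta>') (at t) \<and> \<theta>' \<le> 2 * \<delta> / t * (\<eta> - \<theta> t))"
    by blast
qed (use \<delta> in \<open>auto intro: abs_continuous_\<theta> \<theta>_nonneg\<close>)

text \<open>
  The point \<open>x\<close> is pulled towards \<open>v\<close>, which converges to \<open>z\<close>: since
  \<open>(v - x) \<bullet> (x - z) \<le> |v - z|\<^sup>2 / 2 - |x - z|\<^sup>2 / 2\<close>, the squared distance of \<open>x\<close> to \<open>z\<close> satisfies an
  Euler inequality whose right-hand level \<open>\<theta>\<close> tends to \<open>0\<close>.
\<close>

lemma trajectory_tendsto: "(x \<longlongrightarrow> z) at_top"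
proof -
  define u where "u t = (norm (x t - z))\<^sup>2 / 2" for t
  have "(u \<longlongrightarrow> 0) at_top"
  proof (rule euler_inequality_tendsto_zero[of "\<alpha> - 1"])
    fix \<eta> :: real assume "0 < \<eta>"
    then obtain T where T: "\<And>t. T \<le> t \<Longrightarrow> \<theta> t < \<eta>"
      using order_tendstoD(2)[OF \<theta>_tendsto_0, of \<eta>] by (auto simp: eventually_at_top_linorder)
    have "AE t in lborel. max T t0 \<le> t \<longrightarrow>
        (\<exists>u'. (u has_real_derivative u') (at t) \<and> u' \<le> (\<alpha> - 1) / t * (\<eta> - u t))"
      using energy_inequality
    proof (rule AE_mp, intro AE_I2 impI)
      fix t
      assume 1: "t0 \<le> t \<longrightarrow> energy_at t"
        and t: "max T t0 \<le> t"
      then obtain x' where x': "(x has_vector_derivative x') (at t)"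
        "x' = ((\<alpha> - 1) / t) *\<^sub>R (v t - x t)"
        unfolding energy_at_def by auto
      have "(u has_real_derivative x' \<bullet> (x t - z)) (at t)"
        unfolding u_def by (rule has_derivative_half_square_dist[OF x'(1)])
      moreover have "(v t - x t) \<bullet> (x t - z) \<le> \<theta> t - u t"
      proof -
        have "0 \<le> (norm (v t - x t))\<^sup>2"
          by simp
        also have "(norm (v t - x t))\<^sup>2 =
            (norm (v t - z))\<^sup>2 - (norm (x t - z))\<^sup>2 - 2 * ((v t - x t) \<bullet> (x t - z))"
          by (simp add: power2_norm_eq_inner inner_diff inner_commute)
        also have "\<dots> = 2 * (\<theta> t - u t - (v t - x t) \<bullet> (x t - z))"
          by (simp add: \<theta>_def u_def)
        finally show ?thesis by simp
      qed
      then have "x' \<bullet> (x t - z) \<le> (\<alpha> - 1) / t * (\<eta> - u t)"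
        unfolding x'(2) inner_scaleR_left
        using t t0 \<alpha> T[of t] by (intro mult_left_mono) auto
      ultimately show "\<exists>u'. (u has_real_derivative u') (at t) \<and> u' \<le> (\<alpha> - 1) / t * (\<eta> - u t)"
        by blast
    qed
    then show "\<exists>T. AE t in lborel. T \<le> t \<longrightarrow>
        (\<exists>u'. (u has_real_derivative u') (at t) \<and> u' \<le> (\<alpha> - 1) / t * (\<eta> - u t))"
      by blast
  next
    show "abs_continuous_on_interval u c d" if "t0 \<le> c" "c \<le> d" for c d
      unfolding u_def by (intro abs_continuous_half_square_dist abs_continuous_x that)
  qed (use \<alpha> in \<open>auto simp: u_def\<close>)
  then have "((\<lambda>t. sqrt (2 * u t)) \<longlongrightarrow> sqrt (2 * 0)) at_top"
    by (intro tendsto_real_sqrt tendsto_mult tendsto_const)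
  then have "((\<lambda>t. norm (x t - z)) \<longlongrightarrow> 0) at_top"
    by (simp add: u_def)
  then show ?thesis
    by (simp add: tendsto_norm_zero_iff LIM_zero_iff)
qed

text \<open>
  Jensen's inequality is applied to the weight \<open>t powr p\<close> and to the bound \<open>R\<close>, which is obtained from
  the energy inequality by integrating \<open>- p\<^sup>2 * t powr (p - 2) * \<theta>'\<close> by parts.
\<close>

lemma trajectory_value_bound:
  obtains C where "\<And>t. t0 \<le> t \<Longrightarrow> f (x t) \<le> ereal (m + C / t\<^sup>2)"
proof -
  define p where "p = \<alpha> - 1"
  have p: "2 < p"
    using \<alpha> by (simp add: p_def)
  obtain \<phi>0 where \<phi>0: "f (x t0) = ereal \<phi>0" "m \<le> \<phi>0"
    using start_in_domain lower_bound[of "x t0"] by (cases "f (x t0)") auto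
  define B where "B = (norm z)\<^sup>2 / 2 + \<theta> t0"
  \<comment> \<open>In \<open>E\<close>, the bound \<open>B\<close> absorbs the term left by the integration by parts, the second summand
    the term with \<open>(norm z)\<^sup>2\<close>, and the third the value of \<open>f\<close> at the start. The coefficient
    \<open>t powr (p - 2)\<close> of \<open>E\<close> in \<open>R\<close> increases because \<open>p > 2\<close>.\<close>
  define E where "E = B + \<delta> * (norm z)\<^sup>2 / (p - 2) + t0\<^sup>2 * (\<phi>0 - m) / p\<^sup>2"
  define R where "R t = m * t powr p + p\<^sup>2 * (t powr (p - 2) * (E - \<theta> t))" for t
  have \<theta>_le: "\<theta> t \<le> B" if "t0 \<le> t" for t
    unfolding B_def by (rule \<theta>_bounded[OF that])
  have "f (x b) \<le> ereal (m + (p\<^sup>2 * E) / b\<^sup>2)" if b: "t0 \<le> b" for b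
  proof -
    have "0 < b"
      using b t0 by linarith
    have ac_scalar: "abs_continuous_on_interval (\<lambda>t. t powr q) t0 b" for q
      by (rule abs_continuous_powr[OF t0])
    have ac: "abs_continuous_on_interval (\<lambda>t. (t powr p, t powr p *\<^sub>R x t, R t)) t0 b"
      unfolding R_def using b
      by (intro abs_continuous_Pair ac_scalar abs_continuous_add abs_continuous_diff
          bounded_bilinear.abs_continuous[OF bounded_bilinear_scaleR]
          bounded_bilinear.abs_continuous[OF bounded_bilinear_mult]
          abs_continuous_const abs_continuous_x abs_continuous_\<theta>) auto
    have deriv: "AE t in lborel. t0 \<le> t \<and> t \<le> b \<longrightarrow> (\<exists>c' X' R'.
        ((\<lambda>t. t powr p) has_vector_derivative c') (at t) \<and>
        ((\<lambda>t. t powr p *\<^sub>R x t) has_vector_derivative X') (at t) \<and>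
        (R has_vector_derivative R') (at t) \<and> 0 < c' \<and> f (X' /\<^sub>R c') \<le> ereal (R' / c'))"
      using energy_inequality
    proof (rule AE_mp, intro AE_I2 impI)
      fix t
      assume 1: "t0 \<le> t \<longrightarrow> energy_at t"
        and t: "t0 \<le> t \<and> t \<le> b"
      then obtain \<theta>' x' \<phi> where \<theta>': "(\<theta> has_real_derivative \<theta>') (at t)"
        and x': "(x has_vector_derivative x') (at t)" "x' = (p / t) *\<^sub>R (v t - x t)"
        and \<phi>: "f (v t) = ereal \<phi>" "m \<le> \<phi>"
        and *: "t / p * (\<phi> - m) \<le> - \<theta>' - \<delta> / t * ((norm (v t))\<^sup>2 + 2 * \<theta> t - (norm z)\<^sup>2)"
        unfolding energy_at_def p_def by blast
      have "0 < t"
        using t t0 by linarith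
      define c' where "c' = p * t powr (p - 1)"
      define R' where "R' = m * (p * t powr (p - 1)) +
        p\<^sup>2 * ((p - 2) * t powr (p - 2 - 1) * (E - \<theta> t) - t powr (p - 2) * \<theta>')"
      have c': "((\<lambda>t. t powr p) has_real_derivative c') (at t)"
        unfolding c'_def using \<open>0 < t\<close> by (rule has_real_derivative_powr)
      have "((\<lambda>t. t powr p *\<^sub>R x t) has_vector_derivative t powr p *\<^sub>R x' + c' *\<^sub>R x t) (at t)"
        by (rule has_vector_derivative_scaleR[OF c' x'(1)])
      also have "t powr p *\<^sub>R x' + c' *\<^sub>R x t = c' *\<^sub>R v t"
        using \<open>0 < t\<close> by (simp add: x'(2) c'_def powr_diff algebra_simps)
      finally have X': "((\<lambda>t. t powr p *\<^sub>R x t) has_vector_derivative c' *\<^sub>R v t) (at t)" .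
      have R': "(R has_real_derivative R') (at t)"
        unfolding R_def R'_def using \<open>0 < t\<close> \<theta>'
        by (auto intro!: derivative_eq_intros has_real_derivative_powr simp: algebra_simps)
      have "0 < c'"
        using p \<open>0 < t\<close> by (simp add: c'_def)
      have "c' * \<phi> \<le> R'"
      proof -
        have "0 \<le> \<delta> / t * ((norm (v t))\<^sup>2 + 2 * \<theta> t)"
          using \<delta> \<open>0 < t\<close> \<theta>_nonneg[of t] by auto
        then have "t / p * (\<phi> - m) \<le> \<delta> / t * (norm z)\<^sup>2 - \<theta>'"
          using * by (simp add: algebra_simps)
        then have "p\<^sup>2 * t powr (p - 2) * (t / p * (\<phi> - m)) \<le> p\<^sup>2 * t powr (p - 2) * (\<delta> / t * (norm z)\<^sup>2 - \<theta>')"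
          by (intro mult_left_mono) auto
        also have "p\<^sup>2 * t powr (p - 2) * (t / p * (\<phi> - m)) = c' * (\<phi> - m)"
          using \<open>0 < t\<close> p by (simp add: c'_def powr_diff power2_eq_square)
        finally have 2: "c' * (\<phi> - m) \<le> p\<^sup>2 * t powr (p - 2) * (\<delta> / t * (norm z)\<^sup>2 - \<theta>')" .
        have "0 \<le> t0\<^sup>2 * (\<phi>0 - m) / p\<^sup>2"
          using \<phi>0(2) by simp
        then have "\<delta> * (norm z)\<^sup>2 / (p - 2) \<le> E - \<theta> t"
          using \<theta>_le[of t] t unfolding E_def by linarith
        then have "\<delta> * (norm z)\<^sup>2 \<le> (p - 2) * (E - \<theta> t)"
          using p by (simp add: pos_divide_le_eq mult.commute)
        then have "p\<^sup>2 * t powr (p - 3) * (\<delta> * (norm z)\<^sup>2) \<le> p\<^sup>2 * t powr (p - 3) * ((p - 2) * (E - \<theta> t))"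
          by (intro mult_left_mono) auto
        moreover have "p\<^sup>2 * t powr (p - 2) * (\<delta> / t * (norm z)\<^sup>2) = p\<^sup>2 * t powr (p - 3) * (\<delta> * (norm z)\<^sup>2)"
          using \<open>0 < t\<close> by (simp add: powr_diff power3_eq_cube power2_eq_square)
        ultimately have 3: "p\<^sup>2 * t powr (p - 2) * (\<delta> / t * (norm z)\<^sup>2) \<le>
            p\<^sup>2 * t powr (p - 3) * ((p - 2) * (E - \<theta> t))"
          by simp
        show ?thesis
          using 2 3 by (simp add: R'_def c'_def algebra_simps)
      qed
      then have "f ((c' *\<^sub>R v t) /\<^sub>R c') \<le> ereal (R' / c')"
        using \<open>0 < c'\<close> \<phi>(1) by (simp add: pos_le_divide_eq mult.commute)
      then show "\<exists>c' X' R'. ((\<lambda>t. t powr p) has_vector_derivative c') (at t) \<and>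
          ((\<lambda>t. t powr p *\<^sub>R x t) has_vector_derivative X') (at t) \<and>
          (R has_vector_derivative R') (at t) \<and> 0 < c' \<and> f (X' /\<^sub>R c') \<le> ereal (R' / c')"
        using c' X' R' \<open>0 < c'\<close> unfolding has_real_derivative_iff_has_vector_derivative by blast
    qed
    have "\<phi>0 * t0 powr p \<le> R t0"
    proof -
      have "0 \<le> \<delta> * (norm z)\<^sup>2 / (p - 2)"
        using p \<delta> by simp
      then have "t0\<^sup>2 * (\<phi>0 - m) / p\<^sup>2 \<le> E - \<theta> t0"
        using \<theta>_le[of t0] unfolding E_def by linarith
      then have "t0 powr (p - 2) * (t0\<^sup>2 * (\<phi>0 - m)) \<le> t0 powr (p - 2) * (p\<^sup>2 * (E - \<theta> t0))"
        using p by (intro mult_left_mono) (auto simp: pos_divide_le_eq mult.commute)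
      moreover have "t0 powr (p - 2) * t0\<^sup>2 = t0 powr p"
        using t0 by (simp add: powr_diff)
      ultimately show ?thesis
        by (simp add: R_def algebra_simps)
    qed
    then have start: "f ((t0 powr p *\<^sub>R x t0) /\<^sub>R t0 powr p) \<le> ereal (R t0 / t0 powr p)"
      using t0 \<phi>0(1) by (simp add: pos_le_divide_eq)
    have "f ((b powr p *\<^sub>R x b) /\<^sub>R b powr p) \<le> ereal (R b / b powr p)"
      by (rule convex_function_of_average[OF cvx lsc b ac deriv _ start]) (use t0 \<open>0 < b\<close> in auto)
    then have "f (x b) \<le> ereal (R b / b powr p)"
      using \<open>0 < b\<close> by simp
    also have "R b / b powr p = m + p\<^sup>2 * (E - \<theta> b) / b\<^sup>2"
      using \<open>0 < b\<close> by (simp add: R_def powr_diff add_divide_distrib)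
    also have "\<dots> \<le> m + p\<^sup>2 * E / b\<^sup>2"
      using \<theta>_nonneg[of b] by (auto intro!: divide_right_mono mult_left_mono)
    finally show ?thesis by simp
  qed
  then show ?thesis
    using that by blast
qed

end

theorem theorem8:
  fixes f :: "'a::{real_inner, complete_space} \<Rightarrow> ereal"
    and xs :: 'a and \<alpha> \<delta> t0 :: real and x :: "real \<Rightarrow> 'a"
  assumes "ereal_convex f" and "lower_semicontinuous f" and "proper f"
    and "argmin_set f \<noteq> {}"
    and "is_arg_min norm (\<lambda>z. z \<in> argmin_set f) xs"
    and "\<alpha> > 3" and "\<delta> > 1" and "t0 > 0"
    and "generalized_solution f \<alpha> \<delta> t0 x"
  shows "(\<forall>\<^sub>F t in at_top. f (x t) < \<infinity>) \<and>
         (\<lambda>t. real_of_ereal (f (x t) - (INF z. f z))) \<in> O(\<lambda>t. 1 / t\<^sup>2) \<and>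
         (x \<longlongrightarrow> xs) at_top"
proof -
  have argmin_iff: "y \<in> argmin_set f \<longleftrightarrow> (\<forall>w. f y \<le> f w)" for y
    by (auto simp: argmin_set_def is_arg_min_linorder)
  have xs: "xs \<in> argmin_set f" "\<And>y. y \<in> argmin_set f \<Longrightarrow> norm xs \<le> norm y"
    using assms(5) by (auto simp: is_arg_min_linorder)
  obtain y where "f y < \<infinity>"
    using assms(3) by (auto simp: proper_def)
  then have "f xs \<noteq> \<infinity>" "f xs \<noteq> -\<infinity>"
    using xs(1) assms(3) argmin_iff[of xs] by (auto simp: proper_def)
  then obtain m where m: "f xs = ereal m"
    by (cases "f xs") auto
  obtain v where v: "strong_solution f \<alpha> \<delta> t0 v x" "x t0 \<in> effective_domain f"
    using assms(9) by (auto simp: generalized_solution_def)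
  interpret regularized_descent f \<alpha> \<delta> t0 m xs v x
  proof
    show "ereal m \<le> f y" for y
      using xs(1) m argmin_iff by metis
    then show "f y = ereal m \<Longrightarrow> norm xs \<le> norm y" for y
      by (intro xs(2)) (simp add: argmin_iff)
  qed (use assms m v in \<open>simp_all add: effective_domain_def\<close>)
  have inf: "(INF z. f z) = ereal m"
    using lower_bound m by (intro antisym INF_greatest) (auto intro: INF_lower2[of xs])
  obtain C where C: "\<And>t. t0 \<le> t \<Longrightarrow> f (x t) \<le> ereal (m + C / t\<^sup>2)"
    using trajectory_value_bound by blast
  have "\<forall>\<^sub>F t in at_top. f (x t) < \<infinity>"
    using eventually_ge_at_top[of t0] by eventually_elim (rule le_less_trans[OF C], auto)
  moreover have "(\<lambda>t. real_of_ereal (f (x t) - (INF z. f z))) \<in> O(\<lambda>t. 1 / t\<^sup>2)"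
  proof (rule bigoI)
    show "\<forall>\<^sub>F t in at_top. norm (real_of_ereal (f (x t) - (INF z. f z))) \<le> C * norm (1 / t\<^sup>2)"
      using eventually_ge_at_top[of t0]
    proof eventually_elim
      case (elim t)
      then show ?case
        using C[OF elim] lower_bound[of "x t"] unfolding inf by (cases "f (x t)") auto
    qed
  qed
  ultimately show ?thesis
    using trajectory_tendsto by blast
qed

end
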